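(* Let $X$, $Y$ be Banach spaces over $\mathbb{K}$. Let $0\neq T\in\mathcal{L}(X,Y)$ be such that there is $x_0\in S_X$ satisfying the following conditions: (1) $Tx_0$ is a smooth point of $Y$; (2) every sequence $\{x_n\}\subset B_X$ satisfying $\lim\|Tx_n\|=\|T\|$ has a subsequence converging (in norm) to $\alpha x_0$ for some $\alpha\in\mathbb{T}$. Then $T$ is a smooth point of $\mathcal{L}(X,Y)$.
   Context: $\mathbb{K}$ is $\mathbb{R}$ or $\mathbb{C}$, $\mathbb{T}$ is the set of modulus-one scalars of $\mathbb{K}$. $\mathcal{L}(X,Y)$ is the space of bounded linear operators from $X$ to $Y$ with the operator norm. $B_X$, $S_X$ are the closed unit ball and unit sphere of $X$. A point $z$ of a Banach space $Z$ is smooth if $\{\phi\in Z^*\colon\|\phi\|=1,\ \phi(z)=\|z\|\}$ is a singleton. *)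

theory Defs
  imports "HOL-Analysis.Analysis" "HOL-Library.FuncSet"
begin

text \<open>
  The scalar field \<open>\<bbbK>\<close> is a type isometrically isomorphic, as a real normed algebra, to the reals or
  to the complex numbers.
\<close>

class real_or_complex = real_normed_field +
  assumes real_or_complex:
    "(\<exists>f :: 'a \<Rightarrow> real. bij f \<and> (\<forall>x y. f (x + y) = f x + f y) \<and> (\<forall>r x. f (r *\<^sub>R x) = r *\<^sub>R f x)
        \<and> (\<forall>x y. f (x * y) = f x * f y) \<and> (\<forall>x. norm (f x) = norm x))
   \<or> (\<exists>f :: 'a \<Rightarrow> complex. bij f \<and> (\<forall>x y. f (x + y) = f x + f y) \<and> (\<forall>r x. f (r *\<^sub>R x) = r *\<^sub>R f x)
        \<and> (\<forall>x y. f (x * y) = f x * f y) \<and> (\<forall>x. norm (f x) = norm x))"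

instance real :: real_or_complex
  by standard (rule disjI1, rule exI[of _ id], simp)

instance complex :: real_or_complex
  by standard (rule disjI2, rule exI[of _ id], simp)

text \<open>
  A normed space over \<open>\<bbbK>\<close> is a type of class \<^class>\<open>real_normed_vector\<close> with a scalar multiplication
  by \<open>\<bbbK>\<close> that extends the real one. For a Banach space over \<open>\<bbbK>\<close> the type is moreover required to be of
  class \<^class>\<open>banach\<close>, completeness being independent of the scalar field.
\<close>

locale normed_space_over = vector_space scale
  for scale :: "'k::real_or_complex \<Rightarrow> 'a::real_normed_vector \<Rightarrow> 'a" +
  assumes scale_of_real: "scale (of_real r) x = r *\<^sub>R x"
    and norm_scale: "norm (scale c x) = norm c * norm x"

lemma (in normed_space_over) bounded_linear_scale: "bounded_linear (scale c)"
proof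
  show "scale c (r *\<^sub>R x) = r *\<^sub>R scale c x" for r x
    by (simp flip: scale_of_real add: mult.commute)
  show "\<exists>K. \<forall>x. norm (scale c x) \<le> norm x * K"
    by (rule exI[of _ "norm c"]) (simp add: norm_scale mult.commute)
qed (simp add: scale_right_distrib)

text \<open>
  The type \<open>'a \<Rightarrow>\<^sub>L 'b\<close> consists of the bounded real-linear operators with the operator norm;
  \<open>\<L>(X,Y)\<close> is its subset of \<open>\<bbbK>\<close>-linear operators.
\<close>

definition bounded_operators ::
  "('k \<Rightarrow> 'a \<Rightarrow> 'a) \<Rightarrow> ('k \<Rightarrow> 'b \<Rightarrow> 'b) \<Rightarrow> ('a::real_normed_vector \<Rightarrow>\<^sub>L 'b::real_normed_vector) set"
  where "bounded_operators sX sY = {T. \<forall>c x. blinfun_apply T (sX c x) = sY c (blinfun_apply T x)}"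

definition scale_operator ::
  "('k \<Rightarrow> 'b \<Rightarrow> 'b) \<Rightarrow> 'k \<Rightarrow> ('a::real_normed_vector \<Rightarrow>\<^sub>L 'b::real_normed_vector) \<Rightarrow> ('a \<Rightarrow>\<^sub>L 'b)"
  where "scale_operator sY c T = Blinfun (\<lambda>x. sY c (blinfun_apply T x))"

lemma (in normed_space_over) scale_operator_apply:
  "blinfun_apply (scale_operator scale c T) x = scale c (blinfun_apply T x)"
  unfolding scale_operator_def
  by (subst bounded_linear_Blinfun_apply)
    (auto intro: bounded_linear_compose[OF bounded_linear_scale] blinfun.bounded_linear_right)

lemma normed_space_over_scale_operator:
  assumes "normed_space_over sY"
  shows "normed_space_over (scale_operator sY)"
proof -
  interpret Y: normed_space_over sY by fact
  have norm_le: "norm (scale_operator sY c T) \<le> norm c * norm T" for c T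
    by (rule norm_blinfun_bound)
      (auto simp: Y.scale_operator_apply Y.norm_scale mult.assoc intro: mult_left_mono norm_blinfun)
  have norm_ge: "norm c * norm T \<le> norm (scale_operator sY c T)" for c T
  proof (cases "c = 0")
    case False
    have "scale_operator sY (inverse c) (scale_operator sY c T) = T"
      using False by (intro blinfun_eqI) (simp add: Y.scale_operator_apply)
    with norm_le[of "inverse c" "scale_operator sY c T"] False show ?thesis
      by (simp add: norm_divide field_simps)
  qed simp
  show ?thesis
    by unfold_locales
      (auto intro!: blinfun_eqI antisym norm_le norm_ge
        simp: Y.scale_operator_apply plus_blinfun.rep_eq scaleR_blinfun.rep_eq
          Y.scale_right_distrib Y.scale_left_distrib Y.scale_of_real)
qed

lemma subspace_bounded_operators:
  assumes "normed_space_over sX" "normed_space_over sY"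
  shows "module.subspace (scale_operator sY) (bounded_operators sX sY)"
proof -
  interpret X: normed_space_over sX by fact
  interpret Y: normed_space_over sY by fact
  interpret L: normed_space_over "scale_operator sY"
    by (rule normed_space_over_scale_operator) fact
  show ?thesis
    by (rule L.subspaceI)
      (auto simp: bounded_operators_def Y.scale_operator_apply plus_blinfun.rep_eq
        Y.scale_right_distrib Y.scale_left_commute)
qed

text \<open>
  Dual space of a subspace \<open>V\<close>. Functionals are total functions, so their values outside \<open>V\<close> are
  fixed by \<^const>\<open>extensional\<close>; otherwise no functional on a proper subspace would be unique.
\<close>

definition dual_space ::
  "'z set \<Rightarrow> ('k \<Rightarrow> 'z \<Rightarrow> 'z) \<Rightarrow> ('z::real_normed_vector \<Rightarrow> 'k::real_or_complex) set"
  where "dual_space V sZ = {\<phi> \<in> extensional V.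
    (\<forall>x\<in>V. \<forall>y\<in>V. \<phi> (x + y) = \<phi> x + \<phi> y) \<and>
    (\<forall>c. \<forall>x\<in>V. \<phi> (sZ c x) = c * \<phi> x) \<and>
    (\<exists>C. \<forall>x\<in>V. norm (\<phi> x) \<le> C * norm x)}"

definition dual_norm :: "'z set \<Rightarrow> ('z::real_normed_vector \<Rightarrow> 'k::real_or_complex) \<Rightarrow> real"
  where "dual_norm V \<phi> = (SUP z\<in>{z \<in> V. norm z \<le> 1}. norm (\<phi> z))"

definition smooth_point ::
  "'z set \<Rightarrow> ('k::real_or_complex \<Rightarrow> 'z \<Rightarrow> 'z) \<Rightarrow> 'z::real_normed_vector \<Rightarrow> bool"
  where "smooth_point V sZ z \<longleftrightarrow> z \<in> V \<and>
    is_singleton {\<phi> \<in> dual_space V sZ. dual_norm V \<phi> = 1 \<and> \<phi> z = of_real (norm z)}"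

end

theory Submission imports Defs begin

text \<open>
  Smoothness of \<open>u = T x0\<close> forces, by Hahn--Banach, the one-sided directional derivative of the norm
  of \<open>Y\<close> at \<open>u\<close> to be the real part of the unique support functional \<open>y0\<close>. If \<open>\<phi>\<close> supports the unit
  ball of \<open>L(X,Y)\<close> at \<open>T\<close>, then \<open>Re (\<phi> S)\<close> is at most every difference quotient of the operator norm
  at \<open>T\<close> in direction \<open>S\<close>. By the compactness condition these quotients are asymptotically bounded by
  those of the norm of \<open>Y\<close> at \<open>u\<close> in direction \<open>S x0\<close>. Hence \<open>Re (\<phi> S) \<le> Re (y0 (S x0))\<close>, and
  replacing \<open>S\<close> by its scalar multiples gives \<open>\<phi> S = y0 (S x0)\<close>.
\<close>

section \<open>Sublinear functionals and their one-sided directional derivatives\<close>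

definition sublinear :: "('a::real_vector \<Rightarrow> real) \<Rightarrow> bool" where
  "sublinear p \<longleftrightarrow> (\<forall>x y. p (x + y) \<le> p x + p y) \<and> (\<forall>r\<ge>0. \<forall>x. p (r *\<^sub>R x) = r * p x)"

lemma sublinearI:
  assumes "\<And>x y. p (x + y) \<le> p x + p y" "\<And>r x. r > 0 \<Longrightarrow> p (r *\<^sub>R x) = r * p x" "p 0 = 0"
  shows "sublinear p"
  unfolding sublinear_def
proof (intro conjI allI impI)
  show "p (r *\<^sub>R x) = r * p x" if "0 \<le> r" for r x
    using that assms(2)[of r x] assms(3) by (cases "r = 0") auto
qed (rule assms(1))

lemma sublinear_add: "sublinear p \<Longrightarrow> p (x + y) \<le> p x + p y"
  and sublinear_scaleR: "sublinear p \<Longrightarrow> 0 \<le> r \<Longrightarrow> p (r *\<^sub>R x) = r * p x"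
  by (auto simp: sublinear_def)

lemma sublinear_zero: "sublinear p \<Longrightarrow> p 0 = 0"
  using sublinear_scaleR[of p 0 0] by simp

lemma sublinear_minus_ge: "sublinear p \<Longrightarrow> - p (- x) \<le> p x"
  using sublinear_add[of p x "- x"] sublinear_zero[of p] by simp

lemma sublinear_norm: "sublinear (norm :: 'a::real_normed_vector \<Rightarrow> real)"
  by (rule sublinearI) (auto intro: norm_triangle_ineq)

text \<open>
  With \<open>t\<close> the inverse of the step, this is the one-sided directional derivative of \<open>p\<close> at \<open>v\<close> in
  direction \<open>x\<close>.
\<close>

definition directional :: "('a::real_vector \<Rightarrow> real) \<Rightarrow> 'a \<Rightarrow> 'a \<Rightarrow> real" where
  "directional p v x = (INF t\<in>{0..}. p (x + t *\<^sub>R v) - t * p v)"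

text \<open>Splitting \<open>t *\<^sub>R v\<close> as \<open>(x + t *\<^sub>R v) + (- x)\<close>
  gives the lower bound \<open>- p (- x)\<close>, which is free of \<open>t\<close>. Without a lower
  bound the real \<open>INF\<close> would carry no information.\<close>

lemma bdd_below_directional:
  assumes "sublinear p"
  shows "bdd_below ((\<lambda>t. p (x + t *\<^sub>R v) - t * p v) ` {0..})"
proof (rule bdd_belowI2)
  fix t :: real assume "t \<in> {0..}"
  then have "p (t *\<^sub>R v) = t * p v"
    by (simp add: sublinear_scaleR[OF assms])
  then show "- p (- x) \<le> p (x + t *\<^sub>R v) - t * p v"
    using sublinear_add[OF assms, of "x + t *\<^sub>R v" "- x"] by simp
qed

lemma directional_le:
  assumes "sublinear p" "0 \<le> t"
  shows "directional p v x \<le> p (x + t *\<^sub>R v) - t * p v"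
  unfolding directional_def using assms
  by (intro cINF_lower bdd_below_directional) auto

lemma directional_ge:
  assumes "\<And>t. 0 \<le> t \<Longrightarrow> a \<le> p (x + t *\<^sub>R v) - t * p v"
  shows "a \<le> directional p v x"
  unfolding directional_def using assms by (intro cINF_greatest) auto

lemma directional_le_self: "sublinear p \<Longrightarrow> directional p v x \<le> p x"
  using directional_le[of p 0 v x] by simp

text \<open>At \<open>t = 1\<close> the argument \<open>- v + v\<close> vanishes. A linear
  functional \<open>f\<close> below \<open>directional p v\<close> therefore satisfies
  \<open>f v \<ge> p v\<close>, which is how values are prescribed in the Hahn-Banach
  arguments.\<close>

lemma directional_minus_le:
  assumes "sublinear p" shows "directional p v (- v) \<le> - p v"
  using directional_le[of p 1 v "- v"] sublinear_zero[of p] assms by simp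

text \<open>Rescale the parameter from \<open>t\<close> to \<open>t / r\<close>. The reverse
  inequality comes from the same statement applied to \<open>inverse r\<close> and
  \<open>r *\<^sub>R x\<close>.\<close>

lemma directional_scaleR_ge:
  assumes p: "sublinear p" and r: "r > 0"
  shows "r * directional p v x \<le> directional p v (r *\<^sub>R x)"
proof (rule directional_ge)
  fix t :: real assume t: "0 \<le> t"
  have "p (r *\<^sub>R x + t *\<^sub>R v) = r * p (x + (t / r) *\<^sub>R v)"
    using sublinear_scaleR[OF p, of r "x + (t / r) *\<^sub>R v"] r by (simp add: scaleR_add_right)
  moreover have "r * directional p v x \<le> r * (p (x + (t / r) *\<^sub>R v) - t / r * p v)"
    using r t by (intro mult_left_mono directional_le p) auto
  ultimately show "r * directional p v x \<le> p (r *\<^sub>R x + t *\<^sub>R v) - t * p v"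
    using r by (simp add: right_diff_distrib)
qed

lemma sublinear_directional:
  assumes p: "sublinear p"
  shows "sublinear (directional p v)"
proof (rule sublinearI)
  fix x y
  \<comment> \<open>A parameter \<open>s\<close> for \<open>x\<close> and a parameter
    \<open>t\<close> for \<open>y\<close> combine to \<open>s + t\<close> for \<open>x + y\<close>.
    The infima are taken one at a time, first over \<open>t\<close>, then over
    \<open>s\<close>.\<close>
  have "directional p v (x + y) - (p (x + s *\<^sub>R v) - s * p v) \<le> directional p v y" if s: "0 \<le> s" for s
  proof (rule directional_ge)
    fix t :: real assume t: "0 \<le> t"
    have "directional p v (x + y) \<le> p (x + y + (s + t) *\<^sub>R v) - (s + t) * p v"
      using s t by (intro directional_le p) auto
    also have "p (x + y + (s + t) *\<^sub>R v) \<le> p (x + s *\<^sub>R v) + p (y + t *\<^sub>R v)"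
      using sublinear_add[OF p, of "x + s *\<^sub>R v" "y + t *\<^sub>R v"] by (simp add: algebra_simps)
    finally show "directional p v (x + y) - (p (x + s *\<^sub>R v) - s * p v) \<le> p (y + t *\<^sub>R v) - t * p v"
      by (simp add: algebra_simps)
  qed
  then have "directional p v (x + y) - directional p v y \<le> directional p v x"
    by (intro directional_ge) (auto simp: algebra_simps)
  then show "directional p v (x + y) \<le> directional p v x + directional p v y"
    by simp
next
  fix r :: real and x assume r: "r > 0"
  have "inverse r * directional p v (r *\<^sub>R x) \<le> directional p v x"
    using directional_scaleR_ge[OF p, of "inverse r" v "r *\<^sub>R x"] r by simp
  then have "directional p v (r *\<^sub>R x) \<le> r * directional p v x"
    using r by (simp add: field_simps)
  then show "directional p v (r *\<^sub>R x) = r * directional p v x"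
    using directional_scaleR_ge[OF p r, of v x] by simp
next
  show "directional p v 0 = 0"
  proof (rule antisym)
    show "directional p v 0 \<le> 0"
      using directional_le_self[OF p, of v 0] sublinear_zero[OF p] by simp
    show "0 \<le> directional p v 0"
      by (rule directional_ge) (simp add: sublinear_scaleR[OF p])
  qed
qed

section \<open>The Hahn-Banach theorem and support functionals\<close>

text \<open>
  Hahn--Banach: a minimal sublinear functional \<open>m\<close> is linear, since \<open>directional m v\<close> is a
  sublinear functional below it.
\<close>

lemma sublinear_dominates_linear:
  fixes p :: "'a::real_vector \<Rightarrow> real"
  assumes p: "sublinear p"
  obtains f where "linear f" "f \<le> p"
proof -
  define A where "A = {q. sublinear q \<and> q \<le> p}"
  have "\<exists>m\<in>A. \<forall>a\<in>A. a \<le> m \<longrightarrow> a = m"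
  \<comment> \<open>The order is reversed, so the maximal element of Zorn's lemma is a minimal
    functional and chains need pointwise lower bounds.\<close>
  proof (rule predicate_Zorn)
    show "partial_order_on A (relation_of (\<lambda>a b. b \<le> a) A)"
      by (rule partial_order_on_relation_ofI) auto
  next
    fix C assume C: "C \<in> Chains (relation_of (\<lambda>a b. b \<le> a) A)"
    have CA: "C \<subseteq> A" and Ctot: "\<And>a b. a \<in> C \<Longrightarrow> b \<in> C \<Longrightarrow> a \<le> b \<or> b \<le> a"
      using C by (auto simp: Chains_def relation_of_def)
    have Csub: "sublinear a" if "a \<in> C" for a
      using that CA by (auto simp: A_def)
    show "\<exists>l\<in>A. \<forall>a\<in>C. l \<le> a"
    proof (cases "C = {}")
      case True
      then show ?thesis using p by (auto simp: A_def)
    next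
      case False
      define l where "l x = (INF a\<in>C. a x)" for x
      have bdd: "bdd_below ((\<lambda>a. a x) ` C)" for x
      proof (rule bdd_belowI2)
        fix a assume a: "a \<in> C"
        then have "a (- x) \<le> p (- x)"
          using CA by (auto simp: A_def le_fun_def)
        then show "- p (- x) \<le> a x"
          using sublinear_minus_ge[OF Csub[OF a], of x] by linarith
      qed
      have l_le: "l x \<le> a x" if "a \<in> C" for a x
        unfolding l_def using bdd that by (rule cINF_lower)
      have l_ge: "c \<le> l x" if "\<And>a. a \<in> C \<Longrightarrow> c \<le> a x" for c x
        unfolding l_def using False that by (rule cINF_greatest)
      have scale: "r * l x \<le> l (r *\<^sub>R x)" if "r > 0" for r x
        using that by (intro l_ge) (simp add: sublinear_scaleR[OF Csub] l_le)
      have "sublinear l"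
      proof (rule sublinearI)
        fix x y
        \<comment> \<open>The infima for \<open>x\<close> and for \<open>y\<close> run over
          independent members \<open>a\<close> and \<open>b\<close>. In a chain the smaller of the
          two serves for both.\<close>
        have "l (x + y) \<le> a x + b y" if ab: "a \<in> C" "b \<in> C" for a b
        proof -
          obtain c where c: "c \<in> C" "c \<le> a" "c \<le> b"
            using Ctot[OF ab] ab by auto
          have "l (x + y) \<le> c (x + y)" by (rule l_le) fact
          also have "\<dots> \<le> c x + c y" by (rule sublinear_add[OF Csub[OF c(1)]])
          also have "\<dots> \<le> a x + b y" using c by (intro add_mono) (auto simp: le_fun_def)
          finally show ?thesis .
        qed
        then have "l (x + y) - a x \<le> l y" if "a \<in> C" for a
          using that by (intro l_ge) (simp add: diff_le_eq add.commute[of _ "a x"])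
        then have "l (x + y) - l y \<le> l x"
          by (intro l_ge) (simp add: diff_le_eq add.commute)
        then show "l (x + y) \<le> l x + l y" by simp
      next
        fix r :: real and x assume r: "r > 0"
        have "l (r *\<^sub>R x) \<le> r * l x"
          using scale[of "inverse r" "r *\<^sub>R x"] r by (simp add: field_simps)
        then show "l (r *\<^sub>R x) = r * l x"
          using scale[OF r, of x] by simp
      next
        show "l 0 = 0"
          using False by (simp add: l_def sublinear_zero[OF Csub])
      qed
      moreover have "l \<le> p"
      proof -
        obtain a where "a \<in> C" using False by blast
        then have "l \<le> a" "a \<le> p" using CA by (auto simp: l_le A_def le_fun_def)
        then show ?thesis by (rule order_trans)
      qed
      ultimately show ?thesis
        by (intro bexI[of _ l]) (auto simp: A_def l_le le_fun_def)
    qed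
  qed
  then obtain m where m: "sublinear m" "m \<le> p"
    and min: "\<And>a. sublinear a \<Longrightarrow> a \<le> m \<Longrightarrow> a = m"
    by (force simp: A_def intro: order_trans)
  have dir: "directional m v = m" for v
    by (rule min) (auto simp: le_fun_def sublinear_directional directional_le_self m)
  have minus: "m (- v) = - m v" for v
    using directional_minus_le[OF m(1), of v] sublinear_minus_ge[OF m(1), of v] by (simp add: dir)
  have "linear m"
  proof (rule linearI)
    fix x y r
    \<comment> \<open>Since \<open>directional m y = m\<close>, its bound at \<open>t = 1\<close> is
      superadditivity of \<open>m\<close>.\<close>
    have "m x \<le> m (x + y) - m y"
      using directional_le[OF m(1), of 1 y x] by (simp add: dir)
    then show "m (x + y) = m x + m y"
      using sublinear_add[OF m(1), of x y] by simp
    show "m (r *\<^sub>R x) = r *\<^sub>R m x"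
      using sublinear_scaleR[OF m(1), of r x] sublinear_scaleR[OF m(1), of "- r" x] minus[of "r *\<^sub>R x"]
      by (cases "0 \<le> r") auto
  qed
  then show thesis using m(2) that by blast
qed

text \<open>Apply Hahn-Banach to an iterated derivative: lying below
  \<open>directional norm u\<close> forces \<open>f u = norm u\<close>, and lying below the
  derivative of that functional at \<open>v\<close> forces the value at \<open>v\<close>. If the
  support functional at \<open>u\<close> is unique, its real part is thus the directional
  derivative.\<close>

lemma support_functional_directional:
  fixes u v :: "'a::real_normed_vector"
  obtains f where "linear f" "\<And>x. f x \<le> norm x" "f u = norm u" "f v = directional norm u v"
proof -
  define q where "q = directional norm u"
  have q: "sublinear q"
    unfolding q_def by (intro sublinear_directional sublinear_norm)
  obtain f where f: "linear f" "f \<le> directional q v"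
    using sublinear_dominates_linear sublinear_directional[OF q] by blast
  have f_le_dir: "f x \<le> directional q v x" for x
    using f(2) by (simp add: le_fun_def)
  have f_q: "f x \<le> q x" for x
    using f_le_dir[of x] directional_le_self[OF q, of v x] by linarith
  have f_norm: "f x \<le> norm x" for x
    using f_q[of x] directional_le_self[OF sublinear_norm, of u x] by (simp add: q_def)
  have neg: "f (- x) = - f x" for x
    using f(1) by (rule linear_neg)
  have "f u = norm u"
    using f_norm[of u] f_q[of "- u"] directional_minus_le[OF sublinear_norm, of u]
    by (simp add: q_def neg)
  moreover have "f v = q v"
    using f_q[of v] f_le_dir[of "- v"] directional_minus_le[OF q, of v] by (simp add: neg)
  ultimately show thesis
    using that f(1) f_norm by (simp add: q_def)
qed

section \<open>Real parts of scalars\<close>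

text \<open>
  For real scalars \<open>re\<close> is the identity and \<open>j = 0\<close>; for complex scalars \<open>re\<close> is the real part
  and \<open>j\<close> the imaginary unit.
\<close>

lemma real_or_complex_parts:
  obtains re :: "'k::real_or_complex \<Rightarrow> real" and j :: 'k
  where "linear re" "\<And>r. re (of_real r) = r" "\<And>z. re z \<le> norm z"
    "\<And>z. norm z \<le> re z \<Longrightarrow> z = of_real (re z)" "re j = 0" "j = 0 \<or> j * j = - 1" "\<And>z. z = of_real (re z) - j * of_real (re (j * z))"
  using real_or_complex[where 'a = 'k]
proof
  assume "\<exists>f :: 'k \<Rightarrow> real. bij f \<and> (\<forall>x y. f (x + y) = f x + f y) \<and> (\<forall>r x. f (r *\<^sub>R x) = r *\<^sub>R f x)
        \<and> (\<forall>x y. f (x * y) = f x * f y) \<and> (\<forall>x. norm (f x) = norm x)"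
  then obtain f :: "'k \<Rightarrow> real" where f: "inj f" "\<And>x y. f (x + y) = f x + f y"
    "\<And>r x. f (r *\<^sub>R x) = r *\<^sub>R f x" "\<And>x y. f (x * y) = f x * f y" "\<And>x. norm (f x) = norm x"
    by (auto simp: bij_def)
  have "f 1 = 1"
    using f(4)[of 1 1] f(5)[of 1] by auto
  then have f_real: "f (of_real r) = r" for r
    using f(3)[of r 1] by (simp add: of_real_def)
  show thesis
  proof (rule that[of f 0])
    show "linear f" by (rule linearI) (simp_all add: f)
    show "f z \<le> norm z" for z using f(5)[of z] by simp
    show "z = of_real (f z)" for z by (rule injD[OF f(1)]) (simp add: f_real)
    show "z = of_real (f z) - 0 * of_real (f (0 * z))" for z
      using f(1) by (auto intro!: injD[OF f(1)] simp: f_real)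
  qed (use f_real[of 0] in \<open>auto simp: f_real\<close>)
next
  assume "\<exists>f :: 'k \<Rightarrow> complex. bij f \<and> (\<forall>x y. f (x + y) = f x + f y) \<and> (\<forall>r x. f (r *\<^sub>R x) = r *\<^sub>R f x)
        \<and> (\<forall>x y. f (x * y) = f x * f y) \<and> (\<forall>x. norm (f x) = norm x)"
  then obtain f :: "'k \<Rightarrow> complex" where f: "inj f" "surj f" "\<And>x y. f (x + y) = f x + f y"
    "\<And>r x. f (r *\<^sub>R x) = r *\<^sub>R f x" "\<And>x y. f (x * y) = f x * f y" "\<And>x. norm (f x) = norm x"
    by (auto simp: bij_def)
  have "linear f" by (rule linearI) (simp_all add: f)
  then have f_diff: "f (x - y) = f x - f y" and f_neg: "f (- x) = - f x" for x y
    by (auto intro: linear_diff linear_neg)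
  have "f 1 \<noteq> 0" using f(6)[of 1] by auto
  then have f_1: "f 1 = 1"
    using f(5)[of 1 1] by simp
  then have f_real: "f (of_real r) = of_real r" for r
    using f(4)[of r 1] by (simp add: of_real_def)
  obtain j where j: "f j = \<i>" using f(2) by (metis surjD)
  show thesis
  proof (rule that[of "Re \<circ> f" j])
    show "linear (Re \<circ> f)" by (rule linearI) (simp_all add: f)
    show "(Re \<circ> f) z \<le> norm z" for z using complex_Re_le_cmod[of "f z"] by (simp add: f(6))
    show "z = of_real ((Re \<circ> f) z)" if "norm z \<le> (Re \<circ> f) z" for z
    proof (rule injD[OF f(1)])
      have "cmod (f z) = Re (f z)"
        using that complex_Re_le_cmod[of "f z"] by (simp add: f(6))
      then have "Im (f z) = 0"
        using cmod_power2[of "f z"] by simp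
      then show "f z = f (of_real ((Re \<circ> f) z))" by (simp add: f_real complex_eq_iff)
    qed
    show "j = 0 \<or> j * j = - 1"
      by (rule disjI2, rule injD[OF f(1)]) (simp add: f(5) f_neg f_1 j)
    \<comment> \<open>Since Re(iz) = -Im z, this is the usual splitting into real and imaginary
      parts.\<close>
    show "z = of_real ((Re \<circ> f) z) - j * of_real ((Re \<circ> f) (j * z))" for z
      by (rule injD[OF f(1)]) (simp add: f_diff f(3,5) f_real j complex_eq_iff)
  qed (simp_all add: f_real j)
qed

section \<open>Dual norms, and functionals with prescribed real part\<close>

lemma (in normed_space_over) norm_dual_le:
  assumes V: "subspace V" and \<phi>: "\<phi> \<in> dual_space V scale" and x: "x \<in> V"
  shows "norm (\<phi> x) \<le> dual_norm V \<phi> * norm x"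
proof (cases "x = 0")
  case True
  have "\<phi> (scale 0 x) = 0 * \<phi> x" using \<phi> x unfolding dual_space_def by blast
  then show ?thesis using True by simp
next
  case False
  obtain C where C: "\<And>x. x \<in> V \<Longrightarrow> norm (\<phi> x) \<le> C * norm x"
    using \<phi> unfolding dual_space_def by blast
  \<comment> \<open>The real supremum bounds its members only once boundedness is known. The
    absolute value appears because \<open>C\<close> may be negative.\<close>
  have "bdd_above ((\<lambda>z. norm (\<phi> z)) ` {z \<in> V. norm z \<le> 1})"
  proof (rule bdd_aboveI2)
    fix z assume "z \<in> {z \<in> V. norm z \<le> 1}"
    then have "norm (\<phi> z) \<le> C * norm z" "norm z \<le> 1" using C by auto
    moreover have "C * norm z \<le> \<bar>C\<bar> * 1"
      using \<open>norm z \<le> 1\<close> by (intro mult_mono) auto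
    ultimately show "norm (\<phi> z) \<le> \<bar>C\<bar>" by linarith
  qed
  moreover define c :: 'k where "c = of_real (inverse (norm x))"
  have c: "norm c = inverse (norm x)" by (simp add: c_def norm_inverse)
  have "scale c x \<in> V" using V x by (rule subspace_scale)
  moreover have "norm (scale c x) \<le> 1" using False by (simp add: norm_scale c)
  ultimately have "norm (\<phi> (scale c x)) \<le> dual_norm V \<phi>"
    unfolding dual_norm_def by (intro cSUP_upper) auto
  moreover have "\<phi> (scale c x) = c * \<phi> x"
    using \<phi> x by (simp add: dual_space_def)
  ultimately show ?thesis using False by (simp add: norm_mult c field_simps)
qed

text \<open>Trades the supremum in \<open>dual_norm\<close> for a pointwise bound, which is easy to
  check for explicitly constructed functionals. The value at \<open>z\<close> already forces the
  dual norm to be at least 1.\<close>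

lemma (in normed_space_over) norming_functional_iff:
  assumes V: "subspace V" and z: "z \<in> V" "z \<noteq> 0"
    and \<phi>: "\<phi> \<in> dual_space V scale" "\<phi> z = of_real (norm z)"
  shows "dual_norm V \<phi> = 1 \<longleftrightarrow> (\<forall>x\<in>V. norm (\<phi> x) \<le> norm x)"
proof
  assume "dual_norm V \<phi> = 1"
  then show "\<forall>x\<in>V. norm (\<phi> x) \<le> norm x" using norm_dual_le[OF V \<phi>(1)] by simp
next
  assume le: "\<forall>x\<in>V. norm (\<phi> x) \<le> norm x"
  show "dual_norm V \<phi> = 1"
  proof (rule antisym)
    have "norm z \<le> dual_norm V \<phi> * norm z"
      using norm_dual_le[OF V \<phi>(1) z(1)] \<phi>(2) by simp
    then show "1 \<le> dual_norm V \<phi>" using z(2) by simp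
    show "dual_norm V \<phi> \<le> 1"
      unfolding dual_norm_def
      using le V by (intro cSUP_least) (force simp: intro: subspace_0)+
  qed
qed

text \<open>The classical passage from real to complex functionals, g(x) = f(x) - i f(ix). With
  \<open>j = 0\<close> the same formula returns \<open>f\<close> itself, so both scalar fields are
  treated together.\<close>

lemma (in normed_space_over) dual_functional_with_real_part:
  fixes re :: "'k \<Rightarrow> real" and j :: 'k and f :: "'a \<Rightarrow> real"
  assumes re: "linear re" "\<And>r. re (of_real r) = r" "re j = 0" "j = 0 \<or> j * j = - 1"
      "\<And>z. z = of_real (re z) - j * of_real (re (j * z))"
    and f: "linear f" "\<And>x. f x \<le> norm x"
  obtains g where "g \<in> dual_space UNIV scale" "\<And>x. norm (g x) \<le> norm x" "\<And>x. re (g x) = f x"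
proof -
  define g :: "'a \<Rightarrow> 'k" where "g x = of_real (f x) - j * of_real (f (scale j x))" for x
  have f_scale: "f (r *\<^sub>R x) = r * f x" for r x
    using linear_scale[OF f(1), of r x] by simp
  have add: "g (x + y) = g x + g y" for x y
    by (simp add: g_def scale_right_distrib linear_add[OF f(1)] algebra_simps)
  have scale_scaleR: "scale c (r *\<^sub>R x) = r *\<^sub>R scale c x" for c r x
    by (simp flip: scale_of_real add: mult.commute)
  have g_real: "g (scale (of_real r) x) = of_real r * g x" for r x
    by (simp add: g_def scale_of_real scale_scaleR f_scale algebra_simps)
  have g_j: "g (scale j x) = j * g x" for x
    using re(4)
  proof
    assume "j = 0"
    then show ?thesis using linear_0[OF f(1)] by (simp add: g_def)
  next
    assume jj: "j * j = - 1"
    have "scale j (scale j x) = - x" by (simp add: jj)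
    moreover have "j * (j * a) = - a" for a by (simp add: jj flip: mult.assoc)
    ultimately show ?thesis
      by (simp add: g_def linear_neg[OF f(1)] right_diff_distrib)
  qed
  have g_scale: "g (scale c x) = c * g x" for c x
  proof -
    define a b where "a = re c" and "b = - re (j * c)"
    have c: "c = of_real a + j * of_real b"
      using re(5)[of c] by (simp add: a_def b_def)
    have "scale c x = scale (of_real a) x + scale (of_real b) (scale j x)"
      by (simp add: c scale_left_distrib mult.commute)
    then have "g (scale c x) = of_real a * g x + of_real b * (j * g x)"
      by (simp only: add g_real g_j)
    then show ?thesis by (simp add: c algebra_simps)
  qed
  have re_g: "re (g x) = f x" for x
  proof -
    have "j * of_real (f (scale j x)) = f (scale j x) *\<^sub>R j"
      by (simp add: scaleR_conv_of_real mult.commute)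
    then show ?thesis
      by (simp add: g_def linear_diff[OF re(1)] linear_scale[OF re(1)] re(2,3))
  qed
  have norm_g: "norm (g x) \<le> norm x" for x
  proof (cases "g x = 0")
    case False
    \<comment> \<open>Multiplication by the unimodular \<open>c\<close> rotates \<open>g x\<close>
      onto the positive reals, where \<open>re\<close> recovers the full norm.\<close>
    define c where "c = of_real (norm (g x)) / g x"
    have c: "norm c = 1" "c * g x = of_real (norm (g x))"
      using False by (simp_all add: c_def norm_divide)
    have "norm (g x) = re (g (scale c x))"
      by (simp add: g_scale c re(2))
    also have "\<dots> \<le> norm x"
      using f(2)[of "scale c x"] by (simp add: re_g norm_scale c)
    finally show ?thesis .
  qed simp
  have "g \<in> dual_space UNIV scale"
    unfolding dual_space_def using norm_g by (auto simp: add g_scale intro: exI[of _ 1])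
  then show thesis using that norm_g re_g by blast
qed

section \<open>Difference quotients of the operator norm\<close>

text \<open>A bound \<open>norm A - e\<close> on the whole unit ball would extend by homogeneity to
  an operator bound below \<open>norm A\<close>.\<close>

lemma blinfun_almost_norming:
  fixes A :: "'a::real_normed_vector \<Rightarrow>\<^sub>L 'b::real_normed_vector"
  assumes "e > 0"
  obtains x where "norm x \<le> 1" "norm (blinfun_apply A x) > norm A - e"
proof -
  have "\<exists>x. norm x \<le> 1 \<and> norm (blinfun_apply A x) > norm A - e"
  proof (rule ccontr)
    assume "\<not> ?thesis"
    then have le: "norm (blinfun_apply A x) \<le> norm A - e" if "norm x \<le> 1" for x
      using that by (auto simp: not_less)
    have "norm A \<le> norm A - e"
    proof (rule norm_blinfun_bound)
      show "0 \<le> norm A - e" using le[of 0] by simp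
      fix x
      show "norm (blinfun_apply A x) \<le> (norm A - e) * norm x"
      proof (cases "x = 0")
        case False
        then show ?thesis
          using le[of "inverse (norm x) *\<^sub>R x"] by (simp add: blinfun.scaleR_right field_simps)
      qed simp
    qed
    with assms show False by simp
  qed
  then show thesis using that by blast
qed

text \<open>
  The difference quotients of the norm of \<open>L(X,Y)\<close> at \<open>T\<close> in direction \<open>S\<close> are compared with
  those of the norm of \<open>Y\<close> at \<open>T x0\<close>: nearly norming vectors of \<open>T + t S\<close> are nearly norming
  for \<open>T\<close>, so they accumulate at a unimodular multiple of \<open>x0\<close>. In the form
  \<open>\<parallel>s y + w\<parallel> - s \<parallel>y\<parallel>\<close>, with \<open>s\<close> the inverse of the step, the quotient is decreasing in \<open>s\<close>, which
  allows the limit to be taken at a fixed \<open>s\<close>.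
\<close>

lemma operator_difference_quotient_le:
  fixes sX :: "'k::real_or_complex \<Rightarrow> 'a::real_normed_vector \<Rightarrow> 'a"
    and sY :: "'k \<Rightarrow> 'b::real_normed_vector \<Rightarrow> 'b"
    and T S :: "'a \<Rightarrow>\<^sub>L 'b"
  assumes X: "normed_space_over sX" and Y: "normed_space_over sY"
    and T: "T \<in> bounded_operators sX sY" and S: "S \<in> bounded_operators sX sY"
    and conv: "\<And>x :: nat \<Rightarrow> 'a. \<lbrakk>\<And>n. x n \<in> cball 0 1; (\<lambda>n. norm (blinfun_apply T (x n))) \<longlonglongrightarrow> norm T\<rbrakk>
           \<Longrightarrow> \<exists>\<alpha> r. norm \<alpha> = 1 \<and> strict_mono r \<and> (x \<circ> r) \<longlonglongrightarrow> sX \<alpha> x0"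
    and b: "\<And>t. 0 < t \<Longrightarrow> norm T + t * b \<le> norm (T + t *\<^sub>R S)"
    and s: "0 \<le> s"
  shows "b \<le> norm (blinfun_apply S x0 + s *\<^sub>R blinfun_apply T x0) - s * norm (blinfun_apply T x0)"
proof -
  interpret X: normed_space_over sX by fact
  interpret Y: normed_space_over sY by fact
  define t :: "nat \<Rightarrow> real" where "t n = inverse (real (Suc n))" for n
  have t: "t n > 0" for n by (simp add: t_def)
  have t_lim: "t \<longlonglongrightarrow> 0" unfolding t_def by (rule LIMSEQ_inverse_real_of_nat)
  \<comment> \<open>The tolerance is the square of the step: after division by \<open>t n\<close> an
    error \<open>t n\<close> remains, which still tends to 0.\<close>
  have "\<exists>x. norm x \<le> 1 \<and> norm (blinfun_apply (T + t n *\<^sub>R S) x) > norm (T + t n *\<^sub>R S) - t n * t n" for n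
    using blinfun_almost_norming[of "t n * t n" "T + t n *\<^sub>R S"] t[of n] by auto
  then obtain x where x: "\<And>n. norm (x n) \<le> 1"
    and x_norming: "\<And>n. norm (blinfun_apply (T + t n *\<^sub>R S) (x n)) > norm (T + t n *\<^sub>R S) - t n * t n"
    by metis
  have le_norm: "norm (blinfun_apply A (x n)) \<le> norm A" for A :: "'a \<Rightarrow>\<^sub>L 'b" and n
    using norm_blinfun[of A "x n"] x[of n] by (meson mult_left_le norm_ge_zero order_trans)
  have "(\<lambda>n. norm (blinfun_apply T (x n))) \<longlonglongrightarrow> norm T"
  proof (rule tendsto_sandwich)
    \<comment> \<open>The perturbation costs \<open>t n * norm S\<close> twice: in the operator
      norm, and again in the value at \<open>x n\<close>.\<close>
    have "norm T - 2 * (t n * norm S) - t n * t n \<le> norm (blinfun_apply T (x n))" for n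
    proof -
      have "norm T - t n * norm S \<le> norm (T + t n *\<^sub>R S)"
        using norm_diff_ineq[of T "t n *\<^sub>R S"] t[of n] by simp
      moreover have "norm (blinfun_apply (T + t n *\<^sub>R S) (x n)) \<le> norm (blinfun_apply T (x n)) + t n * norm S"
      proof -
        have "norm (blinfun_apply (T + t n *\<^sub>R S) (x n))
            \<le> norm (blinfun_apply T (x n)) + norm (blinfun_apply (t n *\<^sub>R S) (x n))"
          by (simp add: plus_blinfun.rep_eq norm_triangle_ineq)
        then show ?thesis using le_norm[of "t n *\<^sub>R S" n] t[of n] by simp
      qed
      ultimately show ?thesis using x_norming[of n] by linarith
    qed
    then show "\<forall>\<^sub>F n in sequentially. norm T - 2 * (t n * norm S) - t n * t n \<le> norm (blinfun_apply T (x n))"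
      by simp
    show "\<forall>\<^sub>F n in sequentially. norm (blinfun_apply T (x n)) \<le> norm T"
      by (simp add: le_norm)
    have "(\<lambda>n. norm T - 2 * (t n * norm S) - t n * t n) \<longlonglongrightarrow> norm T - 2 * (0 * norm S) - 0 * 0"
      by (intro tendsto_intros t_lim)
    then show "(\<lambda>n. norm T - 2 * (t n * norm S) - t n * t n) \<longlonglongrightarrow> norm T"
      by simp
  qed simp
  then obtain \<alpha> r where \<alpha>: "norm \<alpha> = 1" and r: "strict_mono r" and lim: "(x \<circ> r) \<longlonglongrightarrow> sX \<alpha> x0"
    using conv[of x] x by auto
  \<comment> \<open>The limit vector is only known up to the factor \<alpha>. The quotient is
    insensitive to it, because \<open>S\<close> and \<open>T\<close> commute with scalars and
    \<alpha> is unimodular.\<close>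
  have invariant: "norm (blinfun_apply S (sX \<alpha> z) + s *\<^sub>R blinfun_apply T (sX \<alpha> z)) - s * norm (blinfun_apply T (sX \<alpha> z))
     = norm (blinfun_apply S z + s *\<^sub>R blinfun_apply T z) - s * norm (blinfun_apply T z)" for z
  proof -
    have "blinfun_apply S (sX \<alpha> z) + s *\<^sub>R blinfun_apply T (sX \<alpha> z)
      = sY \<alpha> (blinfun_apply S z + s *\<^sub>R blinfun_apply T z)"
      using S T by (simp add: bounded_operators_def Y.scale_right_distrib mult.commute flip: Y.scale_of_real)
    moreover have "blinfun_apply T (sX \<alpha> z) = sY \<alpha> (blinfun_apply T z)"
      using T by (simp add: bounded_operators_def)
    ultimately show ?thesis by (simp add: Y.norm_scale \<alpha>)
  qed
  have tr: "(t \<circ> r) \<longlonglongrightarrow> 0" using t_lim r by (rule LIMSEQ_subseq_LIMSEQ)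
  let ?Q = "\<lambda>y. norm (blinfun_apply S y + s *\<^sub>R blinfun_apply T y) - s * norm (blinfun_apply T y)"
  have "b \<le> ?Q (x n) + t n" if n: "s * t n \<le> 1" for n
  proof -
    define y w where "y = blinfun_apply T (x n)" and "w = blinfun_apply S (x n)"
    \<comment> \<open>This splitting is the monotonicity of the quotient: it passes from the moving
      parameter \<open>inverse (t n)\<close> to the smaller fixed \<open>s\<close>. The condition
      \<open>s * t n \<le> 1\<close> keeps the second coefficient nonnegative.\<close>
    have "norm (y + t n *\<^sub>R w) = norm (t n *\<^sub>R (w + s *\<^sub>R y) + (1 - s * t n) *\<^sub>R y)"
      by (simp add: algebra_simps)
    also have "\<dots> \<le> t n * norm (w + s *\<^sub>R y) + (1 - s * t n) * norm y"
      using norm_triangle_ineq[of "t n *\<^sub>R (w + s *\<^sub>R y)" "(1 - s * t n) *\<^sub>R y"] n t[of n] by simp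
    finally have "norm (y + t n *\<^sub>R w) \<le> norm y + t n * (norm (w + s *\<^sub>R y) - s * norm y)"
      by (simp add: algebra_simps)
    moreover have "norm T + t n * b - t n * t n \<le> norm (y + t n *\<^sub>R w)"
      using b[OF t[of n]] x_norming[of n]
      by (simp add: y_def w_def plus_blinfun.rep_eq scaleR_blinfun.rep_eq)
    moreover have "norm y \<le> norm T" unfolding y_def by (rule le_norm)
    ultimately have "t n * b \<le> t n * (norm (w + s *\<^sub>R y) - s * norm y + t n)"
      by (simp add: algebra_simps)
    then show ?thesis using t[of n] by (simp add: y_def w_def)
  qed
  moreover have "\<forall>\<^sub>F n in sequentially. s * (t \<circ> r) n < 1"
  proof -
    have "(\<lambda>n. s * (t \<circ> r) n) \<longlonglongrightarrow> s * 0" by (intro tendsto_intros tr)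
    then show ?thesis by (rule order_tendstoD) simp
  qed
  ultimately have "\<forall>\<^sub>F n in sequentially. b \<le> ?Q ((x \<circ> r) n) + (t \<circ> r) n"
    by (auto elim!: eventually_mono)
  moreover have "(\<lambda>n. ?Q ((x \<circ> r) n) + (t \<circ> r) n) \<longlonglongrightarrow> ?Q (sX \<alpha> x0) + 0"
    by (intro tendsto_intros lim tr)
  ultimately have "b \<le> ?Q (sX \<alpha> x0) + 0"
    by (intro tendsto_lowerbound) auto
  then show ?thesis by (simp add: invariant)
qed

section \<open>Existence and uniqueness of the support functional at the operator\<close>

theorem proposition3p14:
  fixes sX :: "'k::real_or_complex \<Rightarrow> 'a::banach \<Rightarrow> 'a"
    and sY :: "'k \<Rightarrow> 'b::banach \<Rightarrow> 'b"
    and T :: "'a \<Rightarrow>\<^sub>L 'b"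
    and x0 :: 'a
  assumes "normed_space_over sX"
    and "normed_space_over sY"
    and "T \<in> bounded_operators sX sY"
    and "T \<noteq> 0"
    and "x0 \<in> sphere 0 1"
    and "smooth_point UNIV sY (blinfun_apply T x0)"
    and "\<And>x :: nat \<Rightarrow> 'a. \<lbrakk>\<And>n. x n \<in> cball 0 1; (\<lambda>n. norm (blinfun_apply T (x n))) \<longlonglongrightarrow> norm T\<rbrakk>
           \<Longrightarrow> \<exists>\<alpha> r. norm \<alpha> = 1 \<and> strict_mono r \<and> (x \<circ> r) \<longlonglongrightarrow> sX \<alpha> x0"
  shows "smooth_point (bounded_operators sX sY) (scale_operator sY) T"
proof -
  interpret X: normed_space_over sX by fact
  interpret Y: normed_space_over sY by fact
  interpret L: normed_space_over "scale_operator sY"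
    by (rule normed_space_over_scale_operator) fact
  let ?V = "bounded_operators sX sY"
  have V: "L.subspace ?V" by (rule subspace_bounded_operators) fact+
  note T = assms(3)
  have x0: "norm x0 = 1" using assms(5) by simp
  have quotient: "b \<le> norm (blinfun_apply S x0 + s *\<^sub>R blinfun_apply T x0) - s * norm (blinfun_apply T x0)"
    if "S \<in> ?V" "\<And>t. 0 < t \<Longrightarrow> norm T + t * b \<le> norm (T + t *\<^sub>R S)" "0 \<le> s" for b s S
    by (rule operator_difference_quotient_le[OF assms(1,2) T that(1)])
      (rule assms(7) that; assumption?)+
  have apply_le: "norm (blinfun_apply S x0) \<le> norm S" for S :: "'a \<Rightarrow>\<^sub>L 'b"
    using norm_blinfun[of S x0] by (simp add: x0)
  define u where "u = blinfun_apply T x0"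
  have norm_u: "norm u = norm T"
  proof (rule antisym)
    \<comment> \<open>The quotient bound with \<open>S = T\<close>, \<open>b = norm T\<close> and
      \<open>s = 0\<close> shows that \<open>T\<close> attains its norm at
      \<open>x0\<close>.\<close>
    have "norm T + t * norm T \<le> norm (T + t *\<^sub>R T)" if "0 < t" for t
    proof -
      have "norm (T + t *\<^sub>R T) = norm ((1 + t) *\<^sub>R T)" by (simp add: scaleR_left_distrib)
      then show ?thesis using that by (simp add: distrib_right)
    qed
    then have "norm T \<le> norm (blinfun_apply T x0 + 0 *\<^sub>R blinfun_apply T x0) - 0 * norm (blinfun_apply T x0)"
      by (rule quotient[OF T _ order_refl])
    then show "norm T \<le> norm u" by (simp add: u_def)
  qed (simp add: u_def apply_le)
  then have u0: "u \<noteq> 0" using assms(4) by auto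
  obtain re :: "'k \<Rightarrow> real" and j where re: "linear re" "\<And>r. re (of_real r) = r"
    "\<And>z. re z \<le> norm z" "\<And>z. norm z \<le> re z \<Longrightarrow> z = of_real (re z)" "re j = 0" "j = 0 \<or> j * j = - 1"
    "\<And>z. z = of_real (re z) - j * of_real (re (j * z))"
    using real_or_complex_parts by metis
  obtain y0 where y0: "{\<phi> \<in> dual_space UNIV sY. dual_norm UNIV \<phi> = 1 \<and> \<phi> u = of_real (norm u)} = {y0}"
    using assms(6) unfolding smooth_point_def u_def by (auto elim: is_singletonE)
  then have y0_dual: "y0 \<in> dual_space UNIV sY" and y0_u: "y0 u = of_real (norm u)"
    and y0_norm: "dual_norm UNIV y0 = 1"
    by auto
  have y0_le: "norm (y0 y) \<le> norm y" for y
    using Y.norm_dual_le[OF Y.subspace_UNIV y0_dual, of y] y0_norm by simp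
  \<comment> \<open>The functional constructed below depends on \<open>v\<close>, but smoothness at
    \<open>u\<close> identifies it with \<open>y0\<close> for every \<open>v\<close>.\<close>
  have y0_directional: "re (y0 v) = directional norm u v" for v
  proof -
    obtain f where f: "linear f" "\<And>x. f x \<le> norm x" "f u = norm u" "f v = directional norm u v"
      using support_functional_directional by blast
    obtain g where g: "g \<in> dual_space UNIV sY" "\<And>x. norm (g x) \<le> norm x" "\<And>x. re (g x) = f x"
      using Y.dual_functional_with_real_part[OF re(1,2,5,6,7) f(1,2)] by blast
    have "g u = of_real (norm u)"
      using re(4)[of "g u"] g(2,3)[of u] f(3) by simp
    moreover from this have "dual_norm UNIV g = 1"
      using Y.norming_functional_iff[OF Y.subspace_UNIV UNIV_I u0 g(1)] g(2) by simp
    ultimately have "g = y0" using g(1) y0 by blast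
    then show ?thesis using g(3)[of v] f(4) by simp
  qed
  \<comment> \<open>\<open>restrict\<close> provides the default value outside the operator space
    that \<open>extensional\<close> demands.\<close>
  define \<psi> where "\<psi> = restrict (\<lambda>S. y0 (blinfun_apply S x0)) ?V"
  have \<psi>_dual: "\<psi> \<in> dual_space ?V (scale_operator sY)"
    unfolding dual_space_def
  proof (intro CollectI conjI allI ballI)
    show "\<psi> \<in> extensional ?V" by (simp add: \<psi>_def)
    show "\<psi> (A + B) = \<psi> A + \<psi> B" if "A \<in> ?V" "B \<in> ?V" for A B
      using that L.subspace_add[OF V that] y0_dual
      by (simp add: \<psi>_def plus_blinfun.rep_eq dual_space_def)
    show "\<psi> (scale_operator sY c A) = c * \<psi> A" if "A \<in> ?V" for c A
      using that L.subspace_scale[OF V that, of c] y0_dual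
      by (simp add: \<psi>_def Y.scale_operator_apply dual_space_def)
    show "\<exists>C. \<forall>A\<in>?V. norm (\<psi> A) \<le> C * norm A"
      using order_trans[OF y0_le apply_le] by (auto simp: \<psi>_def intro!: exI[of _ 1])
  qed
  have \<psi>_T: "\<psi> T = of_real (norm T)"
    using y0_u by (simp add: \<psi>_def T norm_u flip: u_def)
  have \<psi>_norm: "dual_norm ?V \<psi> = 1"
    unfolding L.norming_functional_iff[OF V T assms(4) \<psi>_dual \<psi>_T]
    using order_trans[OF y0_le apply_le] by (simp add: \<psi>_def)
  have unique: "\<phi> = \<psi>"
    if \<phi>: "\<phi> \<in> dual_space ?V (scale_operator sY)" "dual_norm ?V \<phi> = 1" "\<phi> T = of_real (norm T)" for \<phi>
  proof (rule extensionalityI)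
    show "\<phi> \<in> extensional ?V" "\<psi> \<in> extensional ?V"
      using \<phi>(1) \<psi>_dual by (auto simp: dual_space_def)
    fix S assume S: "S \<in> ?V"
    have \<phi>_add: "\<phi> (A + B) = \<phi> A + \<phi> B" if "A \<in> ?V" "B \<in> ?V" for A B
      using \<phi>(1) that by (simp add: dual_space_def)
    have scale: "\<phi> (scale_operator sY c A) = c * \<phi> A" if "A \<in> ?V" for c A
      using \<phi>(1) that by (simp add: dual_space_def)
    have scale_\<psi>: "\<psi> (scale_operator sY c A) = c * \<psi> A" if "A \<in> ?V" for c A
      using \<psi>_dual that by (simp add: dual_space_def)
    have le: "re (\<phi> A) \<le> re (\<psi> A)" if A: "A \<in> ?V" for A
    proof -
      have "re (\<phi> A) \<le> directional norm u (blinfun_apply A x0)"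
      proof (rule directional_ge)
        fix s :: real assume s: "0 \<le> s"
        \<comment> \<open>The subgradient inequality: \<phi> has norm one and attains
          \<open>norm T\<close> at \<open>T\<close>, so \<open>re (\<phi> A)\<close> lies below
          every difference quotient.\<close>
        have "norm T + t * re (\<phi> A) \<le> norm (T + t *\<^sub>R A)" if t: "0 < t" for t
        proof -
          have tA: "t *\<^sub>R A \<in> ?V"
            using L.subspace_scale[OF V A, of "of_real t"] by (simp add: L.scale_of_real)
          have "\<phi> (t *\<^sub>R A) = of_real t * \<phi> A"
            using scale[OF A, of "of_real t"] by (simp add: L.scale_of_real)
          then have "\<phi> (T + t *\<^sub>R A) = norm T *\<^sub>R 1 + t *\<^sub>R \<phi> A"
            by (simp add: \<phi>_add[OF T tA] \<phi>(3) scaleR_conv_of_real)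
          then have "re (\<phi> (T + t *\<^sub>R A)) = norm T + t * re (\<phi> A)"
            using re(2)[of 1] by (simp add: linear_add[OF re(1)] linear_scale[OF re(1)])
          moreover have "re (\<phi> (T + t *\<^sub>R A)) \<le> norm (\<phi> (T + t *\<^sub>R A))"
            by (rule re(3))
          moreover have "norm (\<phi> (T + t *\<^sub>R A)) \<le> norm (T + t *\<^sub>R A)"
            using L.norm_dual_le[OF V \<phi>(1) L.subspace_add[OF V T tA]] \<phi>(2) by simp
          ultimately show ?thesis by linarith
        qed
        then show "re (\<phi> A) \<le> norm (blinfun_apply A x0 + s *\<^sub>R u) - s * norm u"
          unfolding u_def by (rule quotient[OF A _ s])
      qed
      then show ?thesis by (simp add: \<psi>_def A y0_directional)
    qed
    define d where "d = \<phi> S - \<psi> S"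
    \<comment> \<open>The one-sided estimate holds for every scalar multiple of \<open>S\<close>. If
      \<open>d\<close> were nonzero, \<open>c = inverse d\<close> would give
      \<open>re 1 \<le> 0\<close>.\<close>
    have "re (c * d) \<le> 0" for c
      using le[OF L.subspace_scale[OF V S, of c]]
      by (simp add: d_def scale[OF S] scale_\<psi>[OF S] right_diff_distrib linear_diff[OF re(1)])
    from this[of "inverse d"] have "d = 0"
      using re(2)[of 1] by (cases "d = 0") auto
    then show "\<phi> S = \<psi> S" by (simp add: d_def)
  qed
  have "{\<phi> \<in> dual_space ?V (scale_operator sY). dual_norm ?V \<phi> = 1 \<and> \<phi> T = of_real (norm T)} = {\<psi>}"
    using \<psi>_dual \<psi>_norm \<psi>_T unique by blast
  then show ?thesis
    using T by (simp add: smooth_point_def)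
qed

end
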